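(* Let $\mathbb{B}$ be a separable Banach space with norm $\|\cdot\|$, $(\Omega,\mathcal{F},\mathbb{P})$ a probability space, $(Y_n)$ a sequence of $\mathbb{B}$-valued random variables and $Z_n:=\sum_{i=0}^n Y_i$. Let $(a_n)$ be reals with $0<a_0\le a_1\le\cdots$ and $a_n\to\infty$, and let $f(x):=\min\{n\in\mathbb{N}:a_n\ge x\}$ for $x\ge 0$. Let $\psi:\mathbb{Q}^+\times\mathbb{Q}^+\to\mathbb{N}$, let $(z_n)$ be a sequence of natural numbers, $\varepsilon,\lambda\in\mathbb{Q}^+$ and $k\in\mathbb{N}$, and set $M:=\psi(\varepsilon/4,\lambda/2)$. Suppose $$\mathbb{P}\left(\bigcup_{i=0}^M\{\|Z_i\|\ge z_M\}\right)\le\frac{\lambda}{2}\quad\text{and}\quad\mathbb{P}\left(\max_{M\le m\le k}\|Z_M-Z_m\|\ge\frac{\varepsilon}{4}\right)<\frac{\lambda}{2}.$$ Then $N:=\max\left\{M,\ f\left(\frac{4a_Mz_M}{\varepsilon}\right)\right\}$ satisfies $$\mathbb{P}\left(\max_{N\le n\le k}\left\|\frac{1}{a_n}\sum_{i=0}^n a_iY_i\right\|\ge\varepsilon\right)<\lambda.$$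
   Context: Random variables are tight (Radon) Borel measurable maps $\Omega\to\mathbb{B}$. A maximum over an empty index range is understood so that the corresponding event is empty. *)

theory Defs
  imports "HOL-Probability.Probability"
begin

definition tight_random_variable ::
    "'w measure \<Rightarrow> ('w \<Rightarrow> 'b :: real_normed_vector) \<Rightarrow> bool" where
  "tight_random_variable P X \<longleftrightarrow>
     X \<in> borel_measurable P \<and>
     (\<forall>e>0. \<exists>K. compact K \<and> measure P {\<omega> \<in> space P. X \<omega> \<notin> K} < e)"

text \<open>By Ulam's theorem the tightness clause is automatic in a separable Banach space.\<close>

lemma tight_random_variable_iff_borel_measurable:
  fixes X :: "'w \<Rightarrow> 'b :: {banach, second_countable_topology}"
  assumes "prob_space P"
  shows "tight_random_variable P X \<longleftrightarrow> X \<in> borel_measurable P"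
proof
  assume X: "X \<in> borel_measurable P"
  interpret P: prob_space P by fact
  interpret D: prob_space "distr P borel X" using X by (rule P.prob_space_distr)
  have "\<exists>K. compact K \<and> measure P {\<omega> \<in> space P. X \<omega> \<notin> K} < e" if e: "e > 0" for e :: real
  proof -
    have "emeasure (distr P borel X) UNIV =
        (SUP K \<in> {K. K \<subseteq> UNIV \<and> compact K}. emeasure (distr P borel X) K)"
      by (rule inner_regular) (auto simp: D.emeasure_finite)
    moreover have "ennreal (1 - e) < emeasure (distr P borel X) UNIV"
      using e D.emeasure_space_1 by (simp add: ennreal_less_one_iff)
    ultimately obtain K where K: "compact K" "ennreal (1 - e) < emeasure (distr P borel X) K"
      by (auto simp: less_SUP_iff)
    then have KB: "K \<in> sets borel" by (simp add: compact_imp_closed)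
    have "1 - e < measure (distr P borel X) K"
      using K(2) ennreal_leI[of "measure (distr P borel X) K" "1 - e"]
      by (auto simp: D.emeasure_eq_measure not_le[symmetric])
    also have "\<dots> = P.prob {\<omega> \<in> space P. X \<omega> \<in> K}"
      using X KB by (simp add: measure_distr vimage_def Int_def conj_commute)
    finally have "1 - e < P.prob {\<omega> \<in> space P. X \<omega> \<in> K}" .
    moreover have "{\<omega> \<in> space P. X \<omega> \<in> K} \<in> P.events"
      using X KB by measurable
    then have "P.prob {\<omega> \<in> space P. X \<omega> \<notin> K} = 1 - P.prob {\<omega> \<in> space P. X \<omega> \<in> K}"
      by (rule P.prob_neg)
    ultimately show ?thesis using K(1) by (intro exI[of _ K]) auto
  qed
  with X show "tight_random_variable P X" by (simp add: tight_random_variable_def)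
qed (simp add: tight_random_variable_def)

definition first_index_ge :: "(nat \<Rightarrow> real) \<Rightarrow> real \<Rightarrow> nat" where
  "first_index_ge a x = (LEAST n. a n \<ge> x)"

end

theory Submission
  imports Defs
begin

text \<open>
  By Abel summation, \<open>\<Sum>i\<le>n. a i *\<^sub>R y i\<close> with \<open>0 < a 0 \<le> a 1 \<le> \<dots>\<close> has norm below \<open>2 * a n * c\<close>
  whenever all partial sums of \<open>y\<close> up to \<open>n\<close> have norm below \<open>c\<close>. Off the two exceptional events, this
  applies to \<open>Y 0, \<dots>, Y M\<close> with \<open>c = z M\<close> and to \<open>Y (M + 1), \<dots>, Y n\<close> with \<open>c = \<epsilon> / 4\<close>. As
  \<open>a n \<ge> 4 * a M * z M / \<epsilon>\<close> for \<open>n \<ge> N\<close>, each part contributes less than \<open>\<epsilon> / 2\<close> after division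
  by \<open>a n\<close>.
\<close>

lemma sum_scaleR_by_parts:
  fixes y :: "nat \<Rightarrow> 'b :: real_vector"
  shows "(\<Sum>i=0..n. a i *\<^sub>R y i) =
    a n *\<^sub>R (\<Sum>i=0..n. y i) - (\<Sum>j<n. (a (Suc j) - a j) *\<^sub>R (\<Sum>i=0..j. y i))"
  by (induction n) (simp_all add: algebra_simps)

text \<open>The increments of \<open>a\<close> are nonnegative and telescope to
  \<open>a n - a 0\<close>, so Abel summation gives the bound
  \<open>a n * c + (a n - a 0) * c\<close>. Strictness comes from \<open>0 < a 0\<close> and
  \<open>0 < c\<close>.\<close>

lemma norm_sum_scaleR_less:
  fixes y :: "nat \<Rightarrow> 'b :: real_normed_vector"
  assumes a0: "0 < a 0" and inc: "incseq a"
    and less: "\<And>j. j \<le> n \<Longrightarrow> norm (\<Sum>i=0..j. y i) < c"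
  shows "norm (\<Sum>i=0..n. a i *\<^sub>R y i) < 2 * a n * c"
proof -
  \<comment> \<open>The bound at index 0 already forces \<open>c\<close> to be positive, since it
    exceeds a norm.\<close>
  have c: "0 < c"
    using less[of 0] by (auto intro: le_less_trans[OF norm_ge_zero])
  have an: "0 < a n"
    using a0 incseqD[OF inc, of 0 n] by simp
  have "norm (\<Sum>i=0..n. a i *\<^sub>R y i) \<le>
      norm (a n *\<^sub>R (\<Sum>i=0..n. y i)) + norm (\<Sum>j<n. (a (Suc j) - a j) *\<^sub>R (\<Sum>i=0..j. y i))"
    unfolding sum_scaleR_by_parts by (rule norm_triangle_ineq4)
  also have "norm (a n *\<^sub>R (\<Sum>i=0..n. y i)) \<le> a n * c"
    using an less[of n] by simp
  also have "norm (\<Sum>j<n. (a (Suc j) - a j) *\<^sub>R (\<Sum>i=0..j. y i)) \<le> (\<Sum>j<n. (a (Suc j) - a j) * c)"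
    using incseq_SucD[OF inc] less
    by (intro sum_norm_le) (simp add: mult_left_mono less_imp_le)
  also have "\<dots> = (a n - a 0) * c"
    by (simp add: sum_distrib_right[symmetric] sum_lessThan_telescope)
  also have "a n * c + (a n - a 0) * c < 2 * a n * c"
    using a0 c by (simp add: algebra_simps)
  finally show ?thesis by simp
qed

text \<open>Divergence of \<open>a\<close> makes the set under \<open>LEAST\<close> nonempty, so the
  minimum is attained; monotonicity carries the bound to all later indices.\<close>

lemma first_index_ge_le:
  assumes "incseq a" "filterlim a at_top sequentially" "first_index_ge a x \<le> n"
  shows "x \<le> a n"
proof -
  obtain m where "x \<le> a m"
    using assms(2) by (auto simp: filterlim_at_top eventually_sequentially)
  then have "x \<le> a (first_index_ge a x)"
    unfolding first_index_ge_def by (rule LeastI)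
  with assms show ?thesis
    by (meson incseqD order_trans)
qed

text \<open>Turns a guarded maximum into an existential: an event becomes a finite union, which
  gives measurability, and an outcome yields a witness index. The guard handles the unspecified
  \<open>Max {}\<close>.\<close>

lemma nonempty_le_Max_image_iff:
  fixes g :: "'i \<Rightarrow> 'a :: linorder"
  assumes "finite I"
  shows "I \<noteq> {} \<and> c \<le> Max (g ` I) \<longleftrightarrow> (\<exists>i\<in>I. c \<le> g i)"
  using assms by (cases "I = {}") (auto simp: Max_ge_iff)

text \<open>The deterministic core, applied later to one fixed outcome outside both exceptional
  events.\<close>

lemma norm_weighted_mean_less:
  fixes y :: "nat \<Rightarrow> 'b :: real_normed_vector"
  assumes a0: "0 < a 0" and inc: "incseq a" and "M \<le> n"
    and e: "0 < e" and an_ge: "4 * a M * c / e \<le> a n"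
    and init: "\<And>j. j \<le> M \<Longrightarrow> norm (\<Sum>i=0..j. y i) < c"
    and tail: "\<And>j. M \<le> j \<Longrightarrow> j \<le> n \<Longrightarrow> norm ((\<Sum>i=0..M. y i) - (\<Sum>i=0..j. y i)) < e / 4"
  shows "norm ((1 / a n) *\<^sub>R (\<Sum>i=0..n. a i *\<^sub>R y i)) < e"
proof -
  have an: "0 < a n"
    using a0 incseqD[OF inc, of 0 n] by simp
  \<comment> \<open>Zeroing the terms up to \<open>M\<close> lets the bound for sums starting at 0
    apply to the tail: the partial sums of \<open>y'\<close> vanish up to \<open>M\<close> and are
    differences of those of \<open>y\<close> afterwards.\<close>
  define y' where "y' i = (if i \<le> M then 0 else y i)" for i
  \<comment> \<open>The weights \<open>b\<close> are kept general: the constant 1 serves the partial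
    sums, \<open>a\<close> the weighted sum.\<close>
  have split: "(\<Sum>i=0..j. b i *\<^sub>R y i) = (\<Sum>i=0..M. b i *\<^sub>R y i) + (\<Sum>i=0..j. b i *\<^sub>R y' i)"
    if "M \<le> j" for b j
    using that by (induction rule: dec_induct) (simp_all add: y'_def)
  have "norm (\<Sum>i=0..j. y' i) < e / 4" if "j \<le> n" for j
  proof (cases "M \<le> j")
    case True
    with tail[of j] that split[of j "\<lambda>_. 1"] show ?thesis by simp
  qed (use e in \<open>simp add: y'_def\<close>)
  then have "norm (\<Sum>i=0..n. a i *\<^sub>R y' i) < 2 * a n * (e / 4)"
    by (intro norm_sum_scaleR_less a0 inc)
  moreover have "norm (\<Sum>i=0..M. a i *\<^sub>R y i) < 2 * a M * c"
    by (intro norm_sum_scaleR_less a0 inc init)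
  moreover have "2 * a M * c \<le> a n * e / 2"
    using an_ge e by (simp add: field_simps)
  ultimately have "norm (\<Sum>i=0..n. a i *\<^sub>R y i) < a n * e"
    unfolding split[OF \<open>M \<le> n\<close>]
    by (intro le_less_trans[OF norm_triangle_ineq]) linarith
  with an show ?thesis
    by (simp add: field_simps)
qed

theorem theorem4p3:
  fixes P :: "'w measure"
    and Y :: "nat \<Rightarrow> 'w \<Rightarrow> 'b :: {banach, second_countable_topology}"
    and Z :: "nat \<Rightarrow> 'w \<Rightarrow> 'b"
    and a :: "nat \<Rightarrow> real"
    and f :: "real \<Rightarrow> nat"
    and \<psi> :: "rat \<times> rat \<Rightarrow> nat"
    and z :: "nat \<Rightarrow> nat"
    and \<epsilon> lam :: rat
    and k M N :: nat
  assumes "prob_space P"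
    and "\<And>n. tight_random_variable P (Y n)"
    and "0 < a 0" and "incseq a" and "filterlim a at_top sequentially"
    and "\<epsilon> > 0" and "lam > 0"
  defines "Z \<equiv> \<lambda>n \<omega>. \<Sum>i=0..n. Y i \<omega>"
    and "f \<equiv> \<lambda>x. first_index_ge a x"
    and "M \<equiv> \<psi> (\<epsilon> / 4, lam / 2)"
    and "N \<equiv> max M (f (4 * a M * real (z M) / real_of_rat \<epsilon>))"
  assumes "measure P (\<Union>i\<in>{0..M}. {\<omega> \<in> space P. norm (Z i \<omega>) \<ge> real (z M)})
             \<le> real_of_rat lam / 2"
    and "measure P {\<omega> \<in> space P. {M..k} \<noteq> {} \<and>
             Max ((\<lambda>m. norm (Z M \<omega> - Z m \<omega>)) ` {M..k}) \<ge> real_of_rat \<epsilon> / 4}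
             < real_of_rat lam / 2"
  shows "measure P {\<omega> \<in> space P. {N..k} \<noteq> {} \<and>
             Max ((\<lambda>n. norm ((1 / a n) *\<^sub>R (\<Sum>i=0..n. a i *\<^sub>R Y i \<omega>))) ` {N..k})
               \<ge> real_of_rat \<epsilon>}
             < real_of_rat lam"
proof -
  interpret P: prob_space P by fact
  note [measurable] = \<open>\<And>n. tight_random_variable P (Y n)\<close>[unfolded tight_random_variable_def, THEN conjunct1]
  let ?e = "real_of_rat \<epsilon>"
  let ?A = "\<Union>i\<in>{0..M}. {\<omega> \<in> space P. norm (Z i \<omega>) \<ge> real (z M)}"
  let ?B = "{\<omega> \<in> space P. {M..k} \<noteq> {} \<and> Max ((\<lambda>m. norm (Z M \<omega> - Z m \<omega>)) ` {M..k}) \<ge> ?e / 4}"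
  let ?C = "{\<omega> \<in> space P. {N..k} \<noteq> {} \<and>
    Max ((\<lambda>n. norm ((1 / a n) *\<^sub>R (\<Sum>i=0..n. a i *\<^sub>R Y i \<omega>))) ` {N..k}) \<ge> ?e}"
  have [measurable]: "Z n \<in> borel_measurable P" for n
    unfolding Z_def by measurable
  have A: "?A \<in> sets P"
    by measurable
  have "?B = (\<Union>m\<in>{M..k}. {\<omega> \<in> space P. norm (Z M \<omega> - Z m \<omega>) \<ge> ?e / 4})"
    unfolding nonempty_le_Max_image_iff[OF finite_atLeastAtMost] by blast
  then have B: "?B \<in> sets P"
    by simp
  have "?C \<subseteq> ?A \<union> ?B"
  proof
    fix \<omega> assume C: "\<omega> \<in> ?C"
    then obtain n where n: "N \<le> n" "n \<le> k"
        and ge: "?e \<le> norm ((1 / a n) *\<^sub>R (\<Sum>i=0..n. a i *\<^sub>R Y i \<omega>))"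
      unfolding nonempty_le_Max_image_iff[OF finite_atLeastAtMost] by auto
    show "\<omega> \<in> ?A \<union> ?B"
    proof (rule ccontr)
      assume "\<omega> \<notin> ?A \<union> ?B"
      with C have init: "norm (Z j \<omega>) < real (z M)" if "j \<le> M" for j
        using that by (auto simp: not_le)
      \<comment> \<open>Since \<open>n \<le> k\<close>, each such \<open>j\<close> lies in
        \<open>{M..k}\<close>, the range controlled by \<open>?B\<close>.\<close>
      have tail: "norm (Z M \<omega> - Z j \<omega>) < ?e / 4" if "M \<le> j" "j \<le> n" for j
        using that C n \<open>\<omega> \<notin> ?A \<union> ?B\<close>
        unfolding nonempty_le_Max_image_iff[OF finite_atLeastAtMost] by force
      have "M \<le> n" "4 * a M * real (z M) / ?e \<le> a n"
        using n by (auto simp: N_def f_def intro: first_index_ge_le[OF assms(4,5)])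
      then have "norm ((1 / a n) *\<^sub>R (\<Sum>i=0..n. a i *\<^sub>R Y i \<omega>)) < ?e"
        using init tail \<open>\<epsilon> > 0\<close> \<open>0 < a 0\<close> \<open>incseq a\<close> unfolding Z_def
        by (intro norm_weighted_mean_less[where M = M and c = "real (z M)"]) auto
      with ge show False by simp
    qed
  qed
  \<comment> \<open>Monotonicity asks for the covering event to be measurable, which
    \<open>A\<close> and \<open>B\<close> supply.\<close>
  then have "P.prob ?C \<le> P.prob (?A \<union> ?B)"
    using A B by (intro P.finite_measure_mono) auto
  also have "\<dots> \<le> P.prob ?A + P.prob ?B"
    using A B by (rule measure_Un_le)
  also have "\<dots> < real_of_rat lam"
    \<comment> \<open>The strict bound on \<open>?B\<close> makes the total strict, although
      \<open>?A\<close> may reach \<open>lam / 2\<close>.\<close>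
    using assms(12,13) by linarith
  finally show ?thesis .
qed

end
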